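(* Let $f:\mathbb{R}^d\to\mathbb{R}$ be differentiable and convex with unique minimizer $x_\star$, let $k:\mathbb{R}^d\to\mathbb{R}$ be differentiable and strictly convex with minimum $k(0)=0$ and twice continuously differentiable at every $p\in\mathbb{R}^d\setminus\{0\}$, and let $\gamma\in(0,1)$. Assume: (i) there exist a differentiable, non-increasing, convex function $\alpha:[0,\infty)\to(0,1]$ and a constant $C_{\alpha,\gamma}\in(0,\gamma]$ such that $k(p)\ge\alpha(k(p))\max(f_c^*(p),f_c^*(-p))$ for all $p\in\mathbb{R}^d$ and $-C_{\alpha,\gamma}\alpha'(y)y<\alpha(y)$ for all $y\in[0,\infty)$; (ii) there exists $C_{f,k}\in(0,\infty)$ such that $|\langle\nabla f(x),\nabla k(p)\rangle|\le C_{f,k}\mathcal{H}(x,p)$ for all $x,p\in\mathbb{R}^d$; (iii) there exists $C_k\in(0,\infty)$ such that $\langle\nabla k(p),p\rangle\le C_kk(p)$ for all $p\in\mathbb{R}^d$; (iv) there exists $D_k\in(0,\infty)$ such that $\langle p,\nabla^2k(p)p\rangle\le D_kk(p)$ for all $p\in\mathbb{R}^d\setminus\{0\}$; (v) there exist $E_k,F_k\in(0,\infty)$ such that $k(p)-k(q)\le E_kk(q)+F_k\langle\nabla k(p)-\nabla k(q),p-q\rangle$ for all $p,q\in\mathbb{R}^d$; (vi) there exists $D_{f,k}\in(0,\infty)$ such that $\langle\nabla f(x),\nabla^2k(p)\nabla f(x)\rangle\le D_{f,k}\,\alpha(3\mathcal{H}(x,p))\,\mathcal{H}(x,p)$ for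 all $x\in\mathbb{R}^d$ and $p\in\mathbb{R}^d\setminus\{0\}$. Suppose $$0<\epsilon<\min\Big(\frac{1-\gamma}{2(C_{f,k}+6D_{f,k}/C_{\alpha,\gamma})},\ \frac{1-\gamma}{8D_k(1+E_k)},\ \frac{C_{\alpha,\gamma}}{6(5C_{f,k}+2\gamma C_k)+12\gamma C_{\alpha,\gamma}},\ \sqrt{\frac{1}{6\gamma^2D_kF_k}}\Big).$$ Let $x_0\in\mathbb{R}^d$, $p_0=0$, and for $i\ge0$ $$x_{i+1}=x_i+\epsilon\nabla k(p_i),\qquad p_{i+1}=(1-\epsilon\gamma)p_i-\epsilon\nabla f(x_{i+1}).$$ Let $\mathcal{H}_0=\mathcal{H}(x_0,p_0)$, $\alpha_\star=\alpha(3\mathcal{H}_0)$, $\mathcal{W}_0=f(x_0)-f(x_\star)$, and for $i\ge0$ $$\mathcal{W}_{i+1}=\mathcal{W}_i\Big(1-\frac{\epsilon C_{\alpha,\gamma}}{4}\big[1-\gamma-2\epsilon(C_{f,k}+6D_{f,k}/C_{\alpha,\gamma})\big]\alpha(2\mathcal{W}_i)\Big).$$ Then for every $i\ge0$, $$f(x_i)-f(x_\star)\le2\mathcal{W}_i\le2\mathcal{W}_0\Big(1-\frac{\epsilon C_{\alpha,\gamma}}{4}\big[1-\gamma-2\epsilon(C_{f,k}+6D_{f,k}/C_{\alpha,\gamma})\big]\alpha_\star\Big)^{i}.$$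
   Context: $\langle\cdot,\cdot\rangle$ is the standard inner product on $\mathbb{R}^d$. $f_c(x)=f(x+x_\star)-f(x_\star)$, and $f_c^*(p)=\sup\{\langle x,p\rangle-f_c(x):x\in\mathbb{R}^d\}$ (possibly $+\infty$). $\mathcal{H}(x,p)=k(p)+f(x)-f(x_\star)$. $\nabla^2k$ is the Hessian of $k$. The recursion is the paper's second explicit method. *)

theory Defs
  imports "HOL-Analysis.Analysis"
begin

text \<open>Only meaningful at points where \<open>f\<close> is differentiable.\<close>
definition gradient :: "('a::euclidean_space \<Rightarrow> real) \<Rightarrow> 'a \<Rightarrow> 'a"
  where "gradient f x = (THE g. GDERIV f x :> g)"

definition hessian :: "(real ^ 'n \<Rightarrow> real) \<Rightarrow> real ^ 'n \<Rightarrow> real ^ 'n ^ 'n"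
  where "hessian f x = jacobian (gradient f) (at x)"

text \<open>Intended for open \<open>S\<close>. Differentiability of the gradient already gives its continuity.\<close>
definition twice_continuously_differentiable_on :: "(real ^ 'n \<Rightarrow> real) \<Rightarrow> (real ^ 'n) set \<Rightarrow> bool"
  where "twice_continuously_differentiable_on f S \<longleftrightarrow>
    (\<forall>x\<in>S. f differentiable (at x)) \<and>
    (\<forall>x\<in>S. gradient f differentiable (at x)) \<and>
    continuous_on S (hessian f)"

definition strictly_convex_on :: "'a::real_vector set \<Rightarrow> ('a \<Rightarrow> real) \<Rightarrow> bool"
  where "strictly_convex_on S f \<longleftrightarrow> convex S \<and>
    (\<forall>x\<in>S. \<forall>y\<in>S. \<forall>u>0. \<forall>v>0. u + v = 1 \<longrightarrow> x \<noteq> y \<longrightarrow>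
      f (u *\<^sub>R x + v *\<^sub>R y) < u * f x + v * f y)"

definition unique_minimizer :: "('a \<Rightarrow> real) \<Rightarrow> 'a \<Rightarrow> bool"
  where "unique_minimizer f xm \<longleftrightarrow>
    (\<forall>y. f xm \<le> f y) \<and> (\<forall>x. (\<forall>y. f x \<le> f y) \<longrightarrow> x = xm)"

definition centered :: "('a::ab_group_add \<Rightarrow> real) \<Rightarrow> 'a \<Rightarrow> 'a \<Rightarrow> real"
  where "centered f xm = (\<lambda>x. f (x + xm) - f xm)"

text \<open>Extended-real valued, since the supremum may be infinite.\<close>
definition convex_conjugate :: "('a::real_inner \<Rightarrow> real) \<Rightarrow> 'a \<Rightarrow> ereal"
  where "convex_conjugate g p = (SUP x. ereal (x \<bullet> p - g x))"

definition hamiltonian :: "('a \<Rightarrow> real) \<Rightarrow> ('a \<Rightarrow> real) \<Rightarrow> 'a \<Rightarrow> 'a \<Rightarrow> 'a \<Rightarrow> real"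
  where "hamiltonian f k xm x p = k p + f x - f xm"

end

theory Submission
  imports Defs
begin

text \<open>Write \<open>S = \<langle>x - x\<^sub>\<star>, p\<rangle>\<close> and let \<open>V\<close> solve the implicit equation
  \<open>V = H + \<beta>(V) S\<close> with \<open>\<beta>(v) = C \<alpha>(2 v) / 2\<close>. The Fenchel bound
  \<open>\<bar>S\<bar> \<alpha>(H) \<le> H\<close> and the growth condition on \<open>\<alpha>\<close> give a solution, make
  \<open>v \<mapsto> v - H - \<beta>(v) S\<close> strictly increasing on \<open>v \<ge> H / 2\<close>, and yield
  \<open>H \<le> 2 V\<close>. With the multiplier \<open>\<beta>(V)\<close> frozen at the old value, one step of the method
  decreases \<open>H + \<beta>(V) S\<close> by twice the claimed amount: convexity of \<open>f\<close> handles the position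
  update, and the second-order remainder of \<open>k\<close> along the momentum update is bounded through the
  Hessian conditions, using that the increment is a multiple of \<open>\<gamma> q + \<nabla> f(x')\<close> at every
  point \<open>q\<close> of the segment. Unfreezing the multiplier costs at most the other half. Finally
  \<open>V\<^sub>i \<le> W\<^sub>i\<close> propagates because \<open>w \<mapsto> w (1 - c \<alpha>(2 w))\<close> is monotone.\<close>


section \<open>Gradients, Hessians and convex functions along lines\<close>

lemma gderiv_gradient:
  fixes f :: "'a::euclidean_space \<Rightarrow> real"
  assumes "f differentiable (at x)"
  shows "GDERIV f x :> gradient f x"
proof -
  obtain f' where f': "(f has_derivative f') (at x)"
    using assms unfolding differentiable_def by blast
  then have lin: "linear f'" by (rule has_derivative_linear)
  have "f' = (\<lambda>h. h \<bullet> adjoint f' 1)"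
    using adjoint_works[OF lin, of _ 1] by auto
  with f' have "GDERIV f x :> adjoint f' 1" by (simp add: gderiv_def)
  moreover have "g = h" if "GDERIV f x :> g" "GDERIV f x :> h" for g h
  proof -
    have "(\<lambda>v. v \<bullet> g) = (\<lambda>v. v \<bullet> h)"
      using that unfolding gderiv_def by (rule has_derivative_unique)
    then show ?thesis by (metis inner_commute vector_eq_ldot)
  qed
  ultimately show ?thesis unfolding gradient_def by (metis theI)
qed

lemma DERIV_along_line:
  fixes f :: "'a::euclidean_space \<Rightarrow> real"
  assumes "f differentiable (at (q + t *\<^sub>R d))"
  shows "((\<lambda>t. f (q + t *\<^sub>R d)) has_real_derivative gradient f (q + t *\<^sub>R d) \<bullet> d) (at t)"
proof -
  have 1: "(f has_derivative (\<lambda>h. h \<bullet> gradient f (q + t *\<^sub>R d))) (at (q + t *\<^sub>R d))"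
    using gderiv_gradient[OF assms] by (simp add: gderiv_def)
  have 2: "((\<lambda>t. q + t *\<^sub>R d) has_derivative (\<lambda>h. h *\<^sub>R d)) (at t)"
    by (auto intro!: derivative_eq_intros)
  show ?thesis
    using has_derivative_compose[OF 2 1] unfolding has_field_derivative_def
    by (rule has_derivative_eq_rhs) (simp add: fun_eq_iff inner_commute mult.commute)
qed

lemma convex_on_line:
  assumes "convex_on UNIV f"
  shows "convex_on UNIV (\<lambda>t::real. f (q + t *\<^sub>R d))"
proof (rule convex_onI)
  fix t x y :: real assume t: "0 < t" "t < 1"
  have "q + ((1 - t) *\<^sub>R x + t *\<^sub>R y) *\<^sub>R d = (1 - t) *\<^sub>R (q + x *\<^sub>R d) + t *\<^sub>R (q + y *\<^sub>R d)"
    by (simp add: algebra_simps)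
  then show "f (q + ((1 - t) *\<^sub>R x + t *\<^sub>R y) *\<^sub>R d) \<le> (1 - t) * f (q + x *\<^sub>R d) + t * f (q + y *\<^sub>R d)"
    using convex_onD[OF assms, of t "q + x *\<^sub>R d" "q + y *\<^sub>R d"] t by simp
qed simp

lemma convex_on_gradient_le:
  fixes f :: "'a::euclidean_space \<Rightarrow> real"
  assumes "convex_on UNIV f" "f differentiable (at x)"
  shows "f x + gradient f x \<bullet> (y - x) \<le> f y"
proof -
  have "((\<lambda>t. f (x + t *\<^sub>R (y - x))) has_real_derivative gradient f x \<bullet> (y - x)) (at 0)"
    using DERIV_along_line[of f x 0 "y - x"] assms(2) by simp
  from convex_on_imp_above_tangent[OF convex_on_line[OF assms(1)] connected_UNIV _ _ this, of 1]
  show ?thesis by simp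
qed

lemma gradient_monotone:
  fixes f :: "'a::euclidean_space \<Rightarrow> real"
  assumes "convex_on UNIV f" "f differentiable (at x)" "f differentiable (at y)"
  shows "0 \<le> (gradient f y - gradient f x) \<bullet> (y - x)"
  using convex_on_gradient_le[OF assms(1,2), of y] convex_on_gradient_le[OF assms(1,3), of x]
  by (simp add: inner_diff_left inner_diff_right)

lemma has_derivative_gradient:
  fixes f :: "real ^ 'n \<Rightarrow> real"
  assumes "gradient f differentiable (at q)"
  shows "(gradient f has_derivative (\<lambda>h. hessian f q *v h)) (at q)"
  using assms unfolding hessian_def by (simp add: jacobian_works)

lemma DERIV_gradient_along_line:
  fixes f :: "real ^ 'n \<Rightarrow> real"
  assumes "gradient f differentiable (at (q + t *\<^sub>R d))"
  shows "((\<lambda>t. gradient f (q + t *\<^sub>R d) \<bullet> d) has_real_derivative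
           d \<bullet> (hessian f (q + t *\<^sub>R d) *v d)) (at t)"
proof -
  have 1: "((\<lambda>t. q + t *\<^sub>R d) has_derivative (\<lambda>h. h *\<^sub>R d)) (at t)"
    by (auto intro!: derivative_eq_intros)
  have "((\<lambda>t. gradient f (q + t *\<^sub>R d) \<bullet> d) has_derivative
          (\<lambda>h. (hessian f (q + t *\<^sub>R d) *v (h *\<^sub>R d)) \<bullet> d)) (at t)"
    by (intro has_derivative_inner_left has_derivative_compose[OF 1 has_derivative_gradient[OF assms]])
  then show ?thesis
    unfolding has_field_derivative_def
    by (rule has_derivative_eq_rhs)
       (simp add: fun_eq_iff inner_commute mult.commute matrix_vector_mult_scaleR)
qed

lemma DERIV_nonneg_if_mono:
  fixes g :: "real \<Rightarrow> real"
  assumes "(g has_real_derivative m) (at t)" "mono g"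
  shows "0 \<le> m"
proof (rule ccontr)
  assume "\<not> 0 \<le> m"
  then obtain e where "e > 0" "\<forall>h>0. h < e \<longrightarrow> g t > g (t + h)"
    using DERIV_neg_dec_right[OF assms(1)] by auto
  then have "g (t + e / 2) < g t" by simp
  moreover have "g t \<le> g (t + e / 2)" using \<open>e > 0\<close> by (intro monoD[OF assms(2)]) simp
  ultimately show False by simp
qed

lemma gradient_along_line_mono:
  fixes f :: "'a::euclidean_space \<Rightarrow> real"
  assumes "convex_on UNIV f" "\<And>x. f differentiable (at x)" "s \<le> t"
  shows "gradient f (q + s *\<^sub>R v) \<bullet> v \<le> gradient f (q + t *\<^sub>R v) \<bullet> v"
proof -
  have "0 \<le> (gradient f (q + t *\<^sub>R v) - gradient f (q + s *\<^sub>R v)) \<bullet> ((t - s) *\<^sub>R v)"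
    using gradient_monotone[OF assms(1) assms(2,2), of "q + t *\<^sub>R v" "q + s *\<^sub>R v"]
    by (simp add: algebra_simps)
  then have "0 \<le> (t - s) * (gradient f (q + t *\<^sub>R v) \<bullet> v - gradient f (q + s *\<^sub>R v) \<bullet> v)"
    by (simp add: inner_diff_left)
  then show ?thesis
    using \<open>s \<le> t\<close> by (cases "s = t") (auto simp: zero_le_mult_iff)
qed

lemma hessian_nonneg:
  fixes f :: "real ^ 'n \<Rightarrow> real"
  assumes "convex_on UNIV f" "\<And>x. f differentiable (at x)" "gradient f differentiable (at q)"
  shows "0 \<le> v \<bullet> (hessian f q *v v)"
proof (rule DERIV_nonneg_if_mono)
  show "((\<lambda>t. gradient f (q + t *\<^sub>R v) \<bullet> v) has_real_derivative v \<bullet> (hessian f q *v v)) (at 0)"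
    using DERIV_gradient_along_line[of f q 0 v] assms(3) by simp
  show "mono (\<lambda>t. gradient f (q + t *\<^sub>R v) \<bullet> v)"
    by (rule monoI) (rule gradient_along_line_mono[OF assms(1,2)])
qed

text \<open>By the parallelogram identity, valid for the quadratic form of any matrix, the two sides
  differ by the value of the form at \<open>u - v\<close>.\<close>

lemma hessian_add_le:
  fixes f :: "real ^ 'n \<Rightarrow> real"
  assumes "convex_on UNIV f" "\<And>x. f differentiable (at x)" "gradient f differentiable (at q)"
  shows "(u + v) \<bullet> (hessian f q *v (u + v))
           \<le> 2 * (u \<bullet> (hessian f q *v u)) + 2 * (v \<bullet> (hessian f q *v v))"
  using hessian_nonneg[OF assms, of "u - v"]
  by (simp add: matrix_vector_right_distrib matrix_vector_mult_diff_distrib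
      inner_add_left inner_add_right inner_diff_left inner_diff_right)

text \<open>A convex function that is differentiable everywhere is \<open>C\<^sup>1\<close>: the difference quotients at
  \<open>t\<close> over the step \<open>2 h\<close> squeeze the derivative at \<open>t + h\<close>.\<close>
lemma isCont_derivative_of_convex:
  fixes \<phi> \<psi> :: "real \<Rightarrow> real"
  assumes deriv: "(\<phi> has_real_derivative \<psi> t) (at t)"
    and tangent: "\<And>r s. \<phi> r + \<psi> r * (s - r) \<le> \<phi> s"
  shows "isCont \<psi> t"
proof -
  have "\<exists>\<delta>>0. \<forall>s. s \<noteq> t \<and> norm (s - t) < \<delta> \<longrightarrow> norm (\<psi> s - \<psi> t) < e" if "e > 0" for e
  proof -
    have "(\<lambda>h. (\<phi> (t + h) - \<phi> t) / h) \<midarrow>0\<rightarrow> \<psi> t"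
      using deriv by (simp add: DERIV_def)
    from LIM_D[OF this, of "e / 4"] \<open>e > 0\<close>
    obtain \<delta> where "\<delta> > 0"
      and \<delta>: "\<And>h. h \<noteq> 0 \<Longrightarrow> \<bar>h\<bar> < \<delta> \<Longrightarrow> \<bar>(\<phi> (t + h) - \<phi> t) / h - \<psi> t\<bar> < e / 4" by auto
    have "\<bar>\<psi> (t + h) - \<psi> t\<bar> < e" if h: "h \<noteq> 0" "\<bar>h\<bar> < \<delta> / 2" for h
    proof -
      have "\<bar>(\<phi> (t + 2 * h) - \<phi> t) / (2 * h) - \<psi> t\<bar> < e / 4" using \<delta>[of "2 * h"] h by auto
      moreover have "(\<phi> (t + 2 * h) - \<phi> t) / (2 * h) - \<psi> t
          = (\<phi> (t + 2 * h) - \<phi> t - 2 * h * \<psi> t) / (2 * h)" using h by (simp add: field_simps)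
      ultimately have "\<bar>\<phi> (t + 2 * h) - \<phi> t - 2 * h * \<psi> t\<bar> < e / 4 * (2 * \<bar>h\<bar>)"
        using h by (simp add: abs_mult pos_divide_less_eq)
      then have 1: "\<phi> (t + 2 * h) - \<phi> t - 2 * h * \<psi> t < e / 2 * \<bar>h\<bar>" by linarith
      have 2: "\<phi> (t + h) + \<psi> (t + h) * h \<le> \<phi> (t + 2 * h)"
        using tangent[of "t + h" "t + 2 * h"] by simp
      have 3: "\<phi> t + \<psi> t * h \<le> \<phi> (t + h)" using tangent[of t "t + h"] by simp
      have 4: "\<phi> (t + h) - \<psi> (t + h) * h \<le> \<phi> t" using tangent[of "t + h" t] by simp
      have "(\<psi> (t + h) - \<psi> t) * h < e / 2 * \<bar>h\<bar>" "0 \<le> (\<psi> (t + h) - \<psi> t) * h"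
        using 1 2 3 4 by (auto simp: algebra_simps)
      then have "\<bar>\<psi> (t + h) - \<psi> t\<bar> * \<bar>h\<bar> < e / 2 * \<bar>h\<bar>" by (simp add: abs_mult[symmetric])
      then have "\<bar>\<psi> (t + h) - \<psi> t\<bar> < e / 2" using h by simp
      then show ?thesis using \<open>e > 0\<close> by simp
    qed
    from this[of "s - t" for s] show ?thesis using \<open>\<delta> > 0\<close> by (intro exI[of _ "\<delta> / 2"]) auto
  qed
  then show ?thesis unfolding isCont_def by (intro LIM_I) auto
qed

lemma DERIV_bound_increment:
  fixes g :: "real \<Rightarrow> real"
  assumes "a \<le> b" "continuous_on {a..b} g"
    and "\<And>t. a < t \<Longrightarrow> t < b \<Longrightarrow> \<exists>m\<le>M. (g has_real_derivative m) (at t)"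
  shows "g b - g a \<le> M * (b - a)"
proof -
  have "g b - M * b \<le> g a - M * a"
  proof (rule DERIV_nonpos_imp_decreasing_open[OF assms(1)])
    fix t assume "a < t" "t < b"
    then obtain m where "m \<le> M" "(g has_real_derivative m) (at t)" using assms(3) by blast
    then show "\<exists>y. ((\<lambda>t. g t - M * t) has_real_derivative y) (at t) \<and> y \<le> 0"
      by (intro exI[of _ "m - M"]) (auto intro!: derivative_eq_intros)
  qed (intro continuous_intros assms(2))
  then show ?thesis by (simp add: algebra_simps)
qed

text \<open>The exceptional point \<open>c\<close> allows for a segment through the origin, where
  \<open>k\<close> need not be twice differentiable. Convexity makes \<psi> continuous there, so the
  increments before and after \<open>c\<close> add up; comparing \<phi> with a parabola gives the
  second bound.\<close>

lemma convex_second_order_bound: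
  fixes \<phi> \<psi> :: "real \<Rightarrow> real"
  assumes deriv: "\<And>t. (\<phi> has_real_derivative \<psi> t) (at t)"
    and tangent: "\<And>r s. \<phi> r + \<psi> r * (s - r) \<le> \<phi> s"
    and bound: "\<And>t. 0 < t \<Longrightarrow> t < 1 \<Longrightarrow> t \<noteq> c \<Longrightarrow> \<exists>m\<le>M. (\<psi> has_real_derivative m) (at t)"
  shows "\<psi> 1 - \<psi> 0 \<le> M" "\<phi> 1 - \<phi> 0 - \<psi> 0 \<le> M / 2"
proof -
  have cont: "continuous_on S \<psi>" for S
    using isCont_derivative_of_convex[OF deriv tangent] by (simp add: continuous_at_imp_continuous_on)
  have *: "\<psi> b - \<psi> a \<le> M * (b - a)" if "0 \<le> a" "a \<le> b" "b \<le> 1" "c \<notin> {a<..<b}" for a b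
    using that by (intro DERIV_bound_increment cont bound) auto
  have inc: "\<psi> t - \<psi> 0 \<le> M * t" if "0 \<le> t" "t \<le> 1" for t
  \<comment> \<open>Splitting at \<open>c\<close> leaves open intervals on which the derivative
    bound holds throughout.\<close>
  proof (cases "c \<in> {0<..<t}")
    case True
    then show ?thesis using *[of 0 c] *[of c t] that by (simp add: algebra_simps)
  next
    case False
    then show ?thesis using *[of 0 t] that by simp
  qed
  from inc[of 1] show "\<psi> 1 - \<psi> 0 \<le> M" by simp
  have "\<phi> 1 - \<psi> 0 * 1 - M / 2 * 1\<^sup>2 \<le> \<phi> 0 - \<psi> 0 * 0 - M / 2 * 0\<^sup>2"
  proof (rule DERIV_nonpos_imp_decreasing_open[of 0 1])
    fix t :: real assume "0 < t" "t < 1"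
    then show "\<exists>y. ((\<lambda>t. \<phi> t - \<psi> 0 * t - M / 2 * t\<^sup>2) has_real_derivative y) (at t) \<and> y \<le> 0"
      using inc[of t]
      by (intro exI[of _ "\<psi> t - \<psi> 0 - M * t"]) (auto intro!: derivative_eq_intros deriv)
  next
    have "continuous_on {0..1} \<phi>"
      using deriv by (meson DERIV_isCont continuous_at_imp_continuous_on)
    then show "continuous_on {0..1} (\<lambda>t. \<phi> t - \<psi> 0 * t - M / 2 * t\<^sup>2)"
      by (intro continuous_intros) auto
  qed simp
  then show "\<phi> 1 - \<phi> 0 - \<psi> 0 \<le> M / 2" by simp
qed


section \<open>The rate function and the implicit equation\<close>

locale rate_function =
  fixes \<alpha> \<alpha>' :: "real \<Rightarrow> real" and C :: real
  assumes rate_pos: "0 \<le> y \<Longrightarrow> 0 < \<alpha> y"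
    and rate_le_one: "0 \<le> y \<Longrightarrow> \<alpha> y \<le> 1"
    and rate_deriv: "0 \<le> y \<Longrightarrow> (\<alpha> has_real_derivative \<alpha>' y) (at y within {0..})"
    and rate_antimono: "0 \<le> y \<Longrightarrow> y \<le> z \<Longrightarrow> \<alpha> z \<le> \<alpha> y"
    and rate_convex: "convex_on {0..} \<alpha>"
    and C_pos: "0 < C" and C_less_one: "C < 1"
    and rate_growth: "0 \<le> y \<Longrightarrow> - C * \<alpha>' y * y < \<alpha> y"
begin

text \<open>This contraction estimate makes the implicit equation well behaved. The tangent of
  \<alpha> at \<open>y\<close> bounds the drop of \<alpha>, the growth condition replaces
  \<open>- C * \<alpha>' y * y\<close> by \<open>\<alpha> y\<close>, and the assumption on
  \<open>s\<close> exchanges \<open>y\<close> for \<open>\<bar>s\<bar> * \<alpha> y\<close>.\<close>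

lemma rate_decrease_less:
  assumes "0 \<le> y" "y < z" "\<bar>s\<bar> * \<alpha> y \<le> y"
  shows "C * (\<alpha> y - \<alpha> z) * \<bar>s\<bar> < z - y"
\<comment> \<open>At the endpoint 0 no interior tangent is available, but there the assumption
  forces \<open>s = 0\<close>.\<close>
proof (cases "y = 0")
  case True
  then have "s = 0" using assms(3) rate_pos[of 0] by (simp add: mult_le_0_iff)
  then show ?thesis using assms by simp
next
  case False
  then have y: "0 < y" using assms by simp
  have "\<alpha>' y * (z - y) \<le> \<alpha> z - \<alpha> y"
    by (rule convex_on_imp_above_tangent[OF rate_convex])
       (use y assms rate_deriv in \<open>auto simp: interior_real_atLeast\<close>)
  then have "C * y * (\<alpha> y - \<alpha> z) \<le> C * y * (- \<alpha>' y * (z - y))"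
    using C_pos y by (intro mult_left_mono) auto
  also have "\<dots> = (- C * \<alpha>' y * y) * (z - y)" by simp
  also have "\<dots> < \<alpha> y * (z - y)"
    using rate_growth[of y] assms by (intro mult_strict_right_mono) auto
  finally have 1: "C * y * (\<alpha> y - \<alpha> z) < \<alpha> y * (z - y)" .
  have "C * (\<alpha> y - \<alpha> z) * (\<bar>s\<bar> * \<alpha> y) \<le> C * (\<alpha> y - \<alpha> z) * y"
    using assms rate_antimono[of y z] C_pos by (intro mult_left_mono) auto
  with 1 have "\<alpha> y * (C * (\<alpha> y - \<alpha> z) * \<bar>s\<bar>) < \<alpha> y * (z - y)" by (simp add: algebra_simps)
  then show ?thesis using rate_pos[OF assms(1)] by simp
qed

lemma rate_mult_le:
  assumes "\<bar>s\<bar> * \<alpha> H \<le> H" "0 \<le> H" "H \<le> y"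
  shows "\<bar>s\<bar> * \<alpha> y \<le> H"
  using mult_left_mono[OF rate_antimono[OF assms(2,3)], of "\<bar>s\<bar>"] assms by simp

text \<open>Since \<open>C < 1\<close>, the correction term has absolute value at most
  \<open>H / 2\<close> wherever \<open>H \<le> 2 * v\<close>, so the difference of the two sides
  changes sign between \<open>H / 2\<close> and \<open>3 * H / 2\<close>.\<close>

lemma implicit_solution_exists:
  assumes "\<bar>s\<bar> * \<alpha> H \<le> H" "0 \<le> H"
  shows "\<exists>v. H \<le> 2 * v \<and> v = H + C / 2 * \<alpha> (2 * v) * s"
proof -
  have small: "\<bar>C / 2 * \<alpha> (2 * v) * s\<bar> \<le> H / 2" if "H \<le> 2 * v" for v
  proof -
    have "\<bar>s\<bar> * \<alpha> (2 * v) \<le> H" using rate_mult_le[OF assms that] .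
    moreover have "0 \<le> \<bar>s\<bar> * \<alpha> (2 * v)" using rate_pos[of "2 * v"] that assms by simp
    ultimately have "C / 2 * (\<bar>s\<bar> * \<alpha> (2 * v)) \<le> 1 / 2 * H"
      using C_pos C_less_one by (intro mult_mono) auto
    then show ?thesis using C_pos rate_pos[of "2 * v"] that assms by (simp add: abs_mult algebra_simps)
  qed
  have "continuous_on {0..} \<alpha>"
    using rate_deriv by (auto intro: DERIV_continuous_on)
  then have "continuous_on {H / 2..3 * H / 2} (\<lambda>v. \<alpha> (2 * v))"
    by (rule continuous_on_compose2) (use assms in \<open>auto intro!: continuous_intros\<close>)
  then have "continuous_on {H / 2..3 * H / 2} (\<lambda>v. v - H - C / 2 * \<alpha> (2 * v) * s)"
    by (intro continuous_intros)
  then have "\<exists>v\<ge>H / 2. v \<le> 3 * H / 2 \<and> v - H - C / 2 * \<alpha> (2 * v) * s = 0"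
    by (rule IVT'[rotated 3]) (use assms small[of "H / 2"] small[of "3 * H / 2"] in auto)
  then obtain v where "H / 2 \<le> v" "v - H - C / 2 * \<alpha> (2 * v) * s = 0" by blast
  then show ?thesis by (intro exI[of _ v] conjI) linarith+
qed

lemma implicit_solution_bounds:
  assumes "\<bar>s\<bar> * \<alpha> H \<le> H" "0 \<le> H" "H \<le> 2 * v" "v = H + C / 2 * \<alpha> (2 * v) * s"
  shows "(1 - C / 2) * H \<le> v" "v \<le> (1 + C / 2) * H"
proof -
  have "C / 2 * (\<bar>s\<bar> * \<alpha> (2 * v)) \<le> C / 2 * H"
    using rate_mult_le[OF assms(1-3)] C_pos by simp
  moreover have "C / 2 * (\<bar>s\<bar> * \<alpha> (2 * v)) = \<bar>C / 2 * \<alpha> (2 * v) * s\<bar>"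
    using C_pos rate_pos[of "2 * v"] assms(2,3) by (simp add: abs_mult algebra_simps)
  ultimately show "(1 - C / 2) * H \<le> v" "v \<le> (1 + C / 2) * H"
    using assms(4) by (auto simp: algebra_simps)
qed

lemma implicit_solution_le:
  assumes s: "\<bar>s\<bar> * \<alpha> H \<le> H" "0 \<le> H"
    and v: "H \<le> 2 * v" "v = H + C / 2 * \<alpha> (2 * v) * s"
    and T: "H \<le> 2 * T" "T \<le> u"
    and u: "H + C / 2 * \<alpha> (2 * u) * s + 2 * (u - T) \<le> u"
  shows "v \<le> T"
proof (rule ccontr)
  assume "\<not> v \<le> T"
  have "0 \<le> 2 * T" using s T by simp
  have sT: "\<bar>s\<bar> * \<alpha> (2 * T) \<le> 2 * T" using rate_mult_le[OF s T(1)] T by simp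
  have lip: "\<bar>C / 2 * \<alpha> (2 * T) * s - C / 2 * \<alpha> (2 * w) * s\<bar> < w - T" if "T < w" for w
  proof -
    have "C / 2 * \<alpha> (2 * T) * s - C / 2 * \<alpha> (2 * w) * s = C / 2 * (\<alpha> (2 * T) - \<alpha> (2 * w)) * s"
      by (simp add: algebra_simps)
    moreover have "\<bar>C / 2 * (\<alpha> (2 * T) - \<alpha> (2 * w)) * s\<bar> = C * (\<alpha> (2 * T) - \<alpha> (2 * w)) * \<bar>s\<bar> / 2"
      using that C_pos rate_antimono[OF \<open>0 \<le> 2 * T\<close>, of "2 * w"] by (simp add: abs_mult)
    ultimately show ?thesis
      using rate_decrease_less[OF \<open>0 \<le> 2 * T\<close> _ sT, of "2 * w"] that by simp
  qed
  have "H + C / 2 * \<alpha> (2 * T) * s \<le> T"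
    using lip[of u] u T(2) by (cases "T = u") (auto simp: abs_less_iff)
  moreover have "T < H + C / 2 * \<alpha> (2 * T) * s"
    using lip[of v] v(2) \<open>\<not> v \<le> T\<close> by (auto simp: abs_less_iff)
  ultimately show False by simp
qed

text \<open>The function \<open>y \<mapsto> \<alpha> y * y\<close> need not be monotone, so a lower bound on \<open>h\<close> is needed as well.\<close>
lemma rate_mult_self_le:
  assumes "0 \<le> H" "H \<le> 2 * V" "V \<le> (1 + C / 2) * H"
    and "(1 - C / 12) * H \<le> h" "h \<le> 27 / 25 * H"
  shows "\<alpha> (3 * h) * h \<le> 3 * (\<alpha> (2 * V) * V)"
proof -
  have CH: "0 \<le> C * H" "C * H \<le> H"
    using assms(1) C_pos C_less_one by (auto intro: mult_left_le_one_le)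
  have h: "0 \<le> h" "11 / 12 * H \<le> h" using assms(1,4) CH by (auto simp: algebra_simps)
  show ?thesis
  proof (cases "2 * V \<le> 3 * h")
    case True
    have "\<alpha> (3 * h) \<le> \<alpha> (2 * V)" using True assms by (intro rate_antimono) auto
    moreover have "0 < \<alpha> (2 * V)" using assms by (intro rate_pos) auto
    ultimately have "\<alpha> (3 * h) * h \<le> \<alpha> (2 * V) * (3 * V)"
      using assms h by (intro mult_mono) auto
    then show ?thesis by simp
  next
    case False
    have pos: "0 < \<alpha> (3 * h)" "0 < \<alpha> (2 * V)" using h assms by (auto intro: rate_pos)
    \<comment> \<open>This is the largest \<open>s\<close> that \<open>rate_decrease_less\<close>
      admits at \<open>3 * h\<close>; it turns that lemma into a bound on the drop of \<alpha>
      itself.\<close>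
    have "\<bar>3 * h / \<alpha> (3 * h)\<bar> * \<alpha> (3 * h) \<le> 3 * h" using pos h by simp
    from rate_decrease_less[OF _ _ this, of "2 * V"] False h pos
    have "C * (\<alpha> (3 * h) - \<alpha> (2 * V)) * (3 * h) < (2 * V - 3 * h) * \<alpha> (3 * h)"
      by (simp add: pos_divide_less_eq)
    also have "\<dots> \<le> (C * (3 * h) / 11) * \<alpha> (3 * h)"
    proof (intro mult_right_mono)
      \<comment> \<open>The bounds on \<open>V\<close> and \<open>h\<close> give
        \<open>2 * V - 3 * h \<le> (5 * C / 4 - 1) * H \<le> C * H / 4\<close>, and this line says
        that \<open>C * H / 4\<close> is at most the right-hand side.\<close>
      have "C * (11 / 12 * H) \<le> C * h" using h C_pos by simp
      then show "2 * V - 3 * h \<le> C * (3 * h) / 11"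
        using assms(3,4) C_less_one CH by (simp add: algebra_simps)
    qed (use pos in simp)
    finally have "(C * (3 * h)) * (\<alpha> (3 * h) - \<alpha> (2 * V)) < (C * (3 * h)) * (\<alpha> (3 * h) / 11)"
      by (simp add: algebra_simps)
    then have "\<alpha> (3 * h) - \<alpha> (2 * V) < \<alpha> (3 * h) / 11"
      using mult_nonneg_nonneg[of C "3 * h"] h C_pos by (rule_tac mult_left_less_imp_less) auto
    then have "\<alpha> (3 * h) \<le> 3 * \<alpha> (2 * V)" using pos by simp
    then have "\<alpha> (3 * h) * h \<le> 3 * \<alpha> (2 * V) * V"
      using pos h False by (intro mult_mono) auto
    then show ?thesis by simp
  qed
qed

end


section \<open>Descent along one step of the method\<close>

text \<open>Here \<sigma> stands for \<beta> times \<open>S\<close>, \<open>F\<close> for the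
  objective gap and \<open>k\<close> for the kinetic energy. The difference of the two sides is a
  nonnegative combination of \<open>k\<close>, \<open>F\<close> and the slack in the bound on
  \<sigma>. The subtracted multiple of \<open>k\<close> is a reserve that pays for the kinetic part
  of the second-order remainder.\<close>

lemma dissipation_le:
  fixes \<gamma> C \<beta> k F \<sigma> :: real
  assumes "0 < \<gamma>" "\<gamma> < 1" "0 < C" "C \<le> \<gamma>" "0 \<le> \<beta>" "\<beta> \<le> C / 2" "0 \<le> k" "0 \<le> F"
    and \<sigma>: "- (\<beta> * F + C / 2 * k) \<le> \<sigma>"
  shows "(1 - \<gamma>) * \<beta> * (F + k + \<sigma>) \<le> (\<gamma> - \<beta>) * k + \<gamma> * \<sigma> + \<beta> * F - \<gamma>\<^sup>2 * (1 - \<gamma>) / 4 * k"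
proof -
  have "(1 - \<gamma>) * \<beta> \<le> \<beta>" using assms by (intro mult_left_le_one_le) auto
  then have coeff: "0 \<le> \<gamma> - (1 - \<gamma>) * \<beta>" using assms by linarith
  \<comment> \<open>The coefficient of \<open>k\<close> vanishes in the extreme case
    \<open>C = \<gamma>\<close>, \<open>\<beta> = C / 2\<close>; expressed through the distances to
    that case it is visibly nonnegative.\<close>
  have "0 \<le> (C / 2 - \<beta>) * ((2 - \<gamma>) - (1 - \<gamma>) * C / 2) + (\<gamma> - C) * (1 - (1 - \<gamma>) * (\<gamma> + C) / 4)"
  proof (intro add_nonneg_nonneg mult_nonneg_nonneg)
    have "(1 - \<gamma>) * C \<le> 1 * 1" using assms by (intro mult_mono) auto
    then show "0 \<le> (2 - \<gamma>) - (1 - \<gamma>) * C / 2" using assms by simp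
    have "(1 - \<gamma>) * (\<gamma> + C) \<le> 1 * 2" using assms by (intro mult_mono) auto
    then show "0 \<le> 1 - (1 - \<gamma>) * (\<gamma> + C) / 4" by simp
  qed (use assms in auto)
  also have "\<dots> = \<gamma> - (2 - \<gamma>) * \<beta> - \<gamma> * C / 2 + (1 - \<gamma>) * \<beta> * C / 2 - \<gamma>\<^sup>2 * (1 - \<gamma>) / 4"
    by (simp add: field_simps power2_eq_square)
  finally have "0 \<le> (\<gamma> - (2 - \<gamma>) * \<beta> - \<gamma> * C / 2 + (1 - \<gamma>) * \<beta> * C / 2 - \<gamma>\<^sup>2 * (1 - \<gamma>) / 4) * k
      + (1 - \<gamma>) * \<beta>\<^sup>2 * F"
    using assms by simp
  moreover have "0 \<le> (\<gamma> - (1 - \<gamma>) * \<beta>) * (\<sigma> + (\<beta> * F + C / 2 * k))"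
    using coeff \<sigma> by simp
  moreover have "(\<gamma> - \<beta>) * k + \<gamma> * \<sigma> + \<beta> * F - \<gamma>\<^sup>2 * (1 - \<gamma>) / 4 * k - (1 - \<gamma>) * \<beta> * (F + k + \<sigma>)
      = (\<gamma> - (2 - \<gamma>) * \<beta> - \<gamma> * C / 2 + (1 - \<gamma>) * \<beta> * C / 2 - \<gamma>\<^sup>2 * (1 - \<gamma>) / 4) * k
        + (1 - \<gamma>) * \<beta>\<^sup>2 * F + (\<gamma> - (1 - \<gamma>) * \<beta>) * (\<sigma> + (\<beta> * F + C / 2 * k))"
    by (simp add: field_simps power2_eq_square)
  ultimately show ?thesis by linarith
qed

text \<open>The conditions take the form in which they are applied: the conjugate bound is the real
  inequality \<open>fenchel\<close>, whose absolute value covers both signs of the momentum, and the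
  step-size bounds are cleared of denominators.\<close>

locale hamiltonian_descent = rate_function \<alpha> \<alpha>' C for \<alpha> \<alpha>' C +
  fixes f k :: "real ^ 'd \<Rightarrow> real" and xm :: "real ^ 'd"
    and \<gamma> \<epsilon> Cfk Ck Dk Ek Fk Dfk :: real
  assumes f_diff: "f differentiable (at x)"
    and f_convex: "convex_on UNIV f"
    and f_min: "f xm \<le> f x"
    and k_diff: "k differentiable (at q)"
    and k_convex: "convex_on UNIV k"
    and k_zero: "k 0 = 0"
    and k_nonneg: "0 \<le> k q"
    and k_gradient_diff: "q \<noteq> 0 \<Longrightarrow> gradient k differentiable (at q)"
    and gamma: "0 < \<gamma>" "\<gamma> < 1"
    and C_le: "C \<le> \<gamma>"
    and fenchel: "\<alpha> (k q) * \<bar>(x - xm) \<bullet> q\<bar> \<le> k q + \<alpha> (k q) * (f x - f xm)"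
    and Cfk_pos: "0 < Cfk" and Cfk: "\<bar>gradient f x \<bullet> gradient k q\<bar> \<le> Cfk * hamiltonian f k xm x q"
    and Ck_pos: "0 < Ck" and Ck: "gradient k q \<bullet> q \<le> Ck * k q"
    and Dk_pos: "0 < Dk" and Dk: "q \<noteq> 0 \<Longrightarrow> q \<bullet> (hessian k q *v q) \<le> Dk * k q"
    and Ek_pos: "0 < Ek" and Fk_pos: "0 < Fk"
    and EFk: "k q - k r \<le> Ek * k r + Fk * ((gradient k q - gradient k r) \<bullet> (q - r))"
    and Dfk_pos: "0 < Dfk"
    and Dfk: "q \<noteq> 0 \<Longrightarrow> gradient f x \<bullet> (hessian k q *v gradient f x)
                \<le> Dfk * \<alpha> (3 * hamiltonian f k xm x q) * hamiltonian f k xm x q"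
    and eps_pos: "0 < \<epsilon>"
    and eps1: "2 * \<epsilon> * (Cfk + 6 * Dfk / C) \<le> 1 - \<gamma>"
    and eps2: "8 * \<epsilon> * (Dk * (1 + Ek)) \<le> 1 - \<gamma>"
    and eps3: "30 * (\<epsilon> * Cfk) + 12 * (\<epsilon> * \<gamma> * Ck) + 12 * (\<epsilon> * \<gamma>) * C \<le> C"
    and eps4: "6 * (\<epsilon>\<^sup>2 * \<gamma>\<^sup>2 * Dk * Fk) \<le> 1"
begin

abbreviation H where "H x p \<equiv> hamiltonian f k xm x p"

lemma hamiltonian_nonneg: "0 \<le> H x p"
  using f_min[of x] k_nonneg[of p] by (simp add: hamiltonian_def)

text \<open>The Fenchel bound survives a smaller multiplier: a nonnegative excess \<open>u\<close>
  only shrinks when multiplied by less, and a nonpositive one is harmless because \<open>k p\<close>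
  is nonnegative.\<close>

lemma inner_le_of_rate:
  assumes "0 < a" "a \<le> \<alpha> (k p)"
  shows "a * \<bar>(x - xm) \<bullet> p\<bar> \<le> k p + a * (f x - f xm)"
proof -
  define u where "u = \<bar>(x - xm) \<bullet> p\<bar> - (f x - f xm)"
  have "\<alpha> (k p) * u \<le> k p" using fenchel[of p x] by (simp add: u_def algebra_simps)
  moreover have "a * u \<le> \<alpha> (k p) * u" if "0 \<le> u" using assms that by (simp add: mult_right_mono)
  moreover have "a * u \<le> 0" if "u \<le> 0" using assms that by (simp add: mult_nonneg_nonpos)
  ultimately have "a * u \<le> k p" using k_nonneg[of p] by linarith
  then show ?thesis by (simp add: u_def algebra_simps)
qed

text \<open>Supplies the hypothesis on \<open>s\<close> of the implicit-equation lemmas, with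
  \<open>s = (x - xm) \<bullet> p\<close>. The rate at \<open>H x p\<close> is admissible because
  \<open>k p \<le> H x p\<close>, and \<alpha> \<le> 1 removes it from the objective gap.\<close>

lemma inner_rate_le: "\<bar>(x - xm) \<bullet> p\<bar> * \<alpha> (H x p) \<le> H x p"
proof -
  have kH: "k p \<le> H x p" using f_min[of x] by (simp add: hamiltonian_def)
  have "\<alpha> (H x p) * (f x - f xm) \<le> 1 * (f x - f xm)"
    using f_min[of x] by (intro mult_right_mono rate_le_one hamiltonian_nonneg) simp
  then show ?thesis
    using inner_le_of_rate[OF rate_pos[OF hamiltonian_nonneg[of x p]] rate_antimono[OF k_nonneg kH], of x]
    by (simp add: hamiltonian_def mult.commute)
qed

lemma gradient_inner_self_ge: "k q \<le> gradient k q \<bullet> q"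
  using convex_on_gradient_le[OF k_convex k_diff, of q 0] by (simp add: k_zero)

lemma eps_gamma_le: "\<epsilon> * \<gamma> \<le> 1 / 12"
proof -
  have "0 < \<epsilon> * Cfk" "0 < \<epsilon> * \<gamma> * Ck" using eps_pos Cfk_pos gamma Ck_pos by simp_all
  then have "(12 * (\<epsilon> * \<gamma>)) * C \<le> 1 * C" using eps3 by linarith
  then show ?thesis using C_pos by (simp add: mult_le_cancel_right)
qed

lemma eps_Cfk_le: "\<epsilon> * Cfk \<le> 1 / 30"
proof -
  have "0 < \<epsilon> * \<gamma> * Ck" "0 < \<epsilon> * \<gamma> * C" using eps_pos C_pos gamma Ck_pos by simp_all
  then show ?thesis using eps3 C_less_one by linarith
qed

text \<open>With \<open>x'\<close> the new position, \<open>d\<close> is the momentum increment, so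
  the new momentum is \<open>p + d\<close>.\<close>

context
  fixes x p x' d :: "real ^ 'd"
  assumes x': "x' = x + \<epsilon> *\<^sub>R gradient k p"
    and d: "d = - \<epsilon> *\<^sub>R (\<gamma> *\<^sub>R p + gradient f x')"
begin

lemma position_decrease_le: "f x - \<epsilon> * Cfk * H x p \<le> f x'"
proof -
  have "f x + \<epsilon> * (gradient f x \<bullet> gradient k p) \<le> f x'"
    using convex_on_gradient_le[OF f_convex f_diff, of x x'] by (simp add: x')
  moreover have "\<epsilon> * (- (Cfk * H x p)) \<le> \<epsilon> * (gradient f x \<bullet> gradient k p)"
    using Cfk[of x p] eps_pos by (intro mult_left_mono) (auto simp: abs_le_iff)
  ultimately show ?thesis by simp
qed

lemma position_increase_le: "f x' \<le> f x + \<epsilon> * (gradient f x' \<bullet> gradient k p)"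
  using convex_on_gradient_le[OF f_convex f_diff, of x' x] by (simp add: x')

text \<open>The Hessian conditions at a point of the segment involve that point rather than
  \<open>p\<close>. Substituting for \<open>p\<close> and collecting the multiples of
  \<open>d\<close> achieves this; the prefactor stays at least 11/12 because
  \<open>\<epsilon> * \<gamma> \<le> 1 / 12\<close>.\<close>

lemma increment_rescaled:
  "(1 - t * \<epsilon> * \<gamma>) *\<^sub>R d = - \<epsilon> *\<^sub>R (\<gamma> *\<^sub>R (p + t *\<^sub>R d) + gradient f x')"
  by (simp add: d algebra_simps)

text \<open>Keeps the energy on the whole segment inside the window required by
  \<open>rate_mult_self_le\<close>. For the momentum change, the lower bound uses the tangent of
  \<open>k\<close> at \<open>p\<close> and the upper bound the tangent at the intermediate
  point.\<close>

lemma hamiltonian_along_step: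
  assumes "0 \<le> t" "t \<le> 1"
  shows "(1 - C / 12) * H x p \<le> H x' (p + t *\<^sub>R d)" "H x' (p + t *\<^sub>R d) \<le> 27 / 25 * H x p"
proof -
  define q where "q = p + t *\<^sub>R d"
  define a b where "a = \<epsilon> * Cfk" and "b = \<epsilon> * \<gamma> * Ck"
  have ab: "0 < a" "0 < b" "a \<le> 1 / 30" "5 / 2 * a + b \<le> C / 12"
  proof -
    have "0 < \<epsilon> * \<gamma> * C" using eps_pos gamma C_pos by simp
    then have "30 * a + 12 * b \<le> C" using eps3 unfolding a_def b_def by linarith
    then show "5 / 2 * a + b \<le> C / 12" by simp
  qed (use eps_pos Cfk_pos gamma Ck_pos eps_Cfk_le in \<open>auto simp: a_def b_def\<close>)
  have H_diff: "H x' p = H x p + (f x' - f x)" by (simp add: hamiltonian_def)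
  have nonneg: "0 \<le> H x p" "0 \<le> H x' p" "0 \<le> H x' q" by (rule hamiltonian_nonneg)+
  have cross: "\<bar>\<epsilon> * (gradient f x' \<bullet> gradient k r)\<bar> \<le> a * H x' r" for r
    using mult_left_mono[OF Cfk[of x' r], of \<epsilon>] eps_pos by (simp add: a_def abs_mult)
  have lower: "H x p - a * H x p \<le> H x' p"
    using position_decrease_le H_diff by (simp add: a_def)
  have upper: "H x' p \<le> H x p + a * H x' p"
    using position_increase_le cross[of p] H_diff by (simp add: abs_le_iff)
  have "a * H x' p \<le> 1 / 30 * H x' p" using ab nonneg by (intro mult_right_mono)
  with upper have upper': "29 * H x' p \<le> 30 * H x p" by simp
  then have aH': "29 * (a * H x' p) \<le> 30 * (a * H x p)"
    using mult_left_mono[OF upper', of a] ab by simp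

  have g: "gradient k p \<bullet> d = - (\<epsilon> * \<gamma> * (gradient k p \<bullet> p)) - \<epsilon> * (gradient f x' \<bullet> gradient k p)"
    by (simp add: d inner_add_right inner_commute algebra_simps)
  have "\<epsilon> * \<gamma> * (gradient k p \<bullet> p) \<le> b * k p"
    using mult_left_mono[OF Ck[of p], of "\<epsilon> * \<gamma>"] eps_pos gamma by (simp add: b_def mult.assoc)
  also have "\<dots> \<le> b * H x p"
    using ab f_min[of x] by (intro mult_left_mono) (auto simp: hamiltonian_def)
  finally have gb: "- (b * H x p + a * H x' p) \<le> gradient k p \<bullet> d"
    using cross[of p] by (simp add: g abs_le_iff)
  have "t * (b * H x p + a * H x' p) \<le> b * H x p + a * H x' p"
    using assms ab nonneg by (intro mult_left_le_one_le add_nonneg_nonneg) auto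
  moreover have "- (t * (b * H x p + a * H x' p)) \<le> t * (gradient k p \<bullet> d)"
    using mult_left_mono[OF gb assms(1)] by (simp only: mult_minus_right)
  ultimately have "- (b * H x p + a * H x' p) \<le> t * (gradient k p \<bullet> d)" by linarith
  moreover have "k p + t * (gradient k p \<bullet> d) \<le> k q"
    using convex_on_gradient_le[OF k_convex k_diff, of p q] by (simp add: q_def)
  moreover have Hq: "H x' q = H x' p + (k q - k p)" by (simp add: hamiltonian_def)
  ultimately have "H x p - a * H x p - (b * H x p + a * H x' p) \<le> H x' q"
    using lower by linarith
  \<comment> \<open>The losses are \<open>a\<close> from the position, and \<open>b\<close> plus at
    most \<open>30 / 29 * a\<close> from the momentum; \<open>5 / 2\<close> rounds up
    \<open>59 / 29\<close>.\<close>
  moreover have "(5 / 2 * a + b) * H x p \<le> C / 12 * H x p"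
    using ab nonneg by (intro mult_right_mono)
  moreover have "0 \<le> a * H x p" using ab nonneg by simp
  ultimately show "(1 - C / 12) * H x p \<le> H x' (p + t *\<^sub>R d)"
    using aH' by (simp add: q_def[symmetric] algebra_simps)

  define r where "r = 1 - t * \<epsilon> * \<gamma>"
  have "t * (\<epsilon> * \<gamma>) \<le> 1 * (1 / 12)"
    using assms eps_gamma_le eps_pos gamma by (intro mult_mono) auto
  then have r: "11 / 12 \<le> r" by (simp add: r_def mult.assoc)
  have "r * (gradient k q \<bullet> d) = gradient k q \<bullet> (r *\<^sub>R d)" by simp
  also have "\<dots> = - (\<epsilon> * \<gamma> * (gradient k q \<bullet> q)) - \<epsilon> * (gradient f x' \<bullet> gradient k q)"
    unfolding r_def increment_rescaled q_def[symmetric]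
    by (simp add: inner_add_right inner_commute algebra_simps)
  also have "\<dots> \<le> a * H x' q"
  proof -
    have "0 \<le> gradient k q \<bullet> q" using gradient_inner_self_ge[of q] k_nonneg[of q] by linarith
    then have "0 \<le> \<epsilon> * \<gamma> * (gradient k q \<bullet> q)" using eps_pos gamma by simp
    then show ?thesis using cross[of q] by (simp add: abs_le_iff)
  qed
  finally have rd: "r * (gradient k q \<bullet> d) \<le> a * H x' q" .
  have "11 / 12 * (t * (gradient k q \<bullet> d)) \<le> a * H x' q"
  proof (cases "0 \<le> gradient k q \<bullet> d")
    case True
    have "11 / 12 * (t * (gradient k q \<bullet> d)) \<le> 11 / 12 * (gradient k q \<bullet> d)"
      using assms True by (simp add: mult_left_le_one_le)
    also have "\<dots> \<le> r * (gradient k q \<bullet> d)" using r True by (intro mult_right_mono)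
    finally show ?thesis using rd by simp
  next
    case False
    then have "t * (gradient k q \<bullet> d) \<le> 0" using assms by (simp add: mult_nonneg_nonpos)
    moreover have "0 \<le> a * H x' q" using ab nonneg by simp
    ultimately show ?thesis by simp
  qed
  moreover have "a * H x' q \<le> 1 / 30 * H x' q" using ab nonneg by (intro mult_right_mono)
  moreover have "k q - t * (gradient k q \<bullet> d) \<le> k p"
    using convex_on_gradient_le[OF k_convex k_diff, of q p] by (simp add: q_def)
  \<comment> \<open>The factor is \<open>12 / 11\<close> times \<open>1 / 30\<close>. Combined with
    the \<open>30 / 29\<close> of \<open>upper'\<close> it stays below
    \<open>27 / 25\<close>.\<close>
  ultimately have "H x' q \<le> H x' p + 2 / 55 * H x' q" using Hq by simp
  then show "H x' (p + t *\<^sub>R d) \<le> 27 / 25 * H x p"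
    using upper' nonneg by (simp add: q_def[symmetric])
qed

text \<open>After rescaling, the form splits into a damping part, controlled by \<open>Dk\<close>,
  and a force part, controlled by \<open>Dfk\<close>; \<open>rate_mult_self_le\<close> then moves
  the rate from the intermediate point to \<open>V\<close>. The left factor is the square of
  11/12.\<close>

lemma hessian_along_step:
  assumes "0 \<le> t" "t \<le> 1" "p + t *\<^sub>R d \<noteq> 0" "H x p \<le> 2 * V" "V \<le> (1 + C / 2) * H x p"
  shows "121 / 144 * (d \<bullet> (hessian k (p + t *\<^sub>R d) *v d))
    \<le> 2 * \<epsilon>\<^sup>2 * \<gamma>\<^sup>2 * Dk * k (p + t *\<^sub>R d) + 6 * \<epsilon>\<^sup>2 * Dfk * (\<alpha> (2 * V) * V)"
proof -
  define q A r where "q = p + t *\<^sub>R d" and "A = hessian k q" and "r = 1 - t * \<epsilon> * \<gamma>"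
  have q: "q \<noteq> 0" using assms by (simp add: q_def)
  have "t * (\<epsilon> * \<gamma>) \<le> 1 * (1 / 12)"
    using assms eps_gamma_le eps_pos gamma by (intro mult_mono) auto
  then have "11 / 12 \<le> r" by (simp add: r_def mult.assoc)
  then have "(11 / 12)\<^sup>2 \<le> r\<^sup>2" by (intro power_mono) auto
  then have "121 / 144 * (d \<bullet> (A *v d)) \<le> r\<^sup>2 * (d \<bullet> (A *v d))"
    unfolding A_def using hessian_nonneg[OF k_convex k_diff k_gradient_diff[OF q]]
    by (intro mult_right_mono) (auto simp: power2_eq_square)
  also have "\<dots> = (r *\<^sub>R d) \<bullet> (A *v (r *\<^sub>R d))"
    by (simp add: matrix_vector_mult_scaleR power2_eq_square)
  also have "\<dots> = \<epsilon>\<^sup>2 * ((\<gamma> *\<^sub>R q + gradient f x') \<bullet> (A *v (\<gamma> *\<^sub>R q + gradient f x')))"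
    unfolding r_def increment_rescaled q_def[symmetric]
    by (simp only: matrix_vector_mult_scaleR) (simp add: power2_eq_square)
  also have "\<dots> \<le> \<epsilon>\<^sup>2 * (2 * ((\<gamma> *\<^sub>R q) \<bullet> (A *v (\<gamma> *\<^sub>R q))) + 2 * (gradient f x' \<bullet> (A *v gradient f x')))"
    unfolding A_def
    by (intro mult_left_mono hessian_add_le k_convex k_diff k_gradient_diff q) simp
  also have "\<dots> \<le> \<epsilon>\<^sup>2 * (2 * (\<gamma>\<^sup>2 * (Dk * k q)) + 2 * (Dfk * (3 * (\<alpha> (2 * V) * V))))"
  proof (intro mult_left_mono add_mono)
    have "\<gamma>\<^sup>2 * (q \<bullet> (A *v q)) \<le> \<gamma>\<^sup>2 * (Dk * k q)"
      unfolding A_def using Dk[OF q] by (intro mult_left_mono) auto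
    then show "(\<gamma> *\<^sub>R q) \<bullet> (A *v (\<gamma> *\<^sub>R q)) \<le> \<gamma>\<^sup>2 * (Dk * k q)"
      by (simp add: matrix_vector_mult_scaleR power2_eq_square mult.assoc)
    have "Dfk * (\<alpha> (3 * H x' q) * H x' q) \<le> Dfk * (3 * (\<alpha> (2 * V) * V))"
      using Dfk_pos hamiltonian_along_step[OF assms(1,2)]
        rate_mult_self_le[OF hamiltonian_nonneg assms(4,5), of "H x' q"]
      by (simp add: q_def)
    then show "gradient f x' \<bullet> (A *v gradient f x') \<le> Dfk * (3 * (\<alpha> (2 * V) * V))"
      using Dfk[OF q, of x'] by (simp add: A_def mult.assoc)
  qed auto
  finally show ?thesis by (simp add: A_def q_def algebra_simps)
qed

text \<open>The \<open>Dk\<close> bound yields \<open>k\<close> at intermediate points.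
  \<open>EFk\<close> returns it to \<open>k p\<close> plus a multiple of \<open>Q\<close>, the total
  growth of the directional derivative. As \<open>Q\<close> is itself bounded by the second
  derivative, it can be absorbed.\<close>

lemma kinetic_remainder_le:
  assumes V: "H x p \<le> 2 * V" "V \<le> (1 + C / 2) * H x p"
  shows "k (p + d) \<le> k p + gradient k p \<bullet> d
    + 2 * \<epsilon>\<^sup>2 * \<gamma>\<^sup>2 * (Dk * (1 + Ek)) * k p + 6 * \<epsilon>\<^sup>2 * Dfk * (\<alpha> (2 * V) * V)"
proof -
  define \<psi> Q where "\<psi> t = gradient k (p + t *\<^sub>R d) \<bullet> d" and "Q = \<psi> 1 - \<psi> 0" for t :: real
  define N where "N = 2 * \<epsilon>\<^sup>2 * \<gamma>\<^sup>2 * (Dk * (1 + Ek)) * k p + 6 * \<epsilon>\<^sup>2 * Dfk * (\<alpha> (2 * V) * V)"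
  have V0: "0 \<le> V" using V hamiltonian_nonneg[of x p] by linarith
  have N: "0 \<le> N"
    unfolding N_def using V0 k_nonneg[of p] Dk_pos Ek_pos Dfk_pos rate_pos[of "2 * V"]
    by (intro add_nonneg_nonneg mult_nonneg_nonneg) auto
  have mono: "\<psi> s \<le> \<psi> t" if "s \<le> t" for s t
    unfolding \<psi>_def using that by (intro gradient_along_line_mono k_convex k_diff)
  \<comment> \<open>For nonzero \<open>d\<close> the line meets the origin at most once; this is the
    exceptional point of \<open>convex_second_order_bound\<close>.\<close>
  obtain c where c: "\<And>t. t \<noteq> c \<Longrightarrow> d \<noteq> 0 \<Longrightarrow> p + t *\<^sub>R d \<noteq> 0"
  proof (cases "\<exists>c. p + c *\<^sub>R d = 0")
    case True
    then obtain c where "p + c *\<^sub>R d = 0" by blast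
    then have "p + t *\<^sub>R d = (t - c) *\<^sub>R d" for t
      by (metis add_diff_cancel_left diff_zero scaleR_left_diff_distrib)
    then show ?thesis using that[of c] by simp
  qed (use that in auto)
  have bound: "\<exists>m\<le>144 / 121 * (N + Q / 3). (\<psi> has_real_derivative m) (at t)"
    if t: "0 < t" "t < 1" "t \<noteq> c" and "d \<noteq> 0" for t
  proof (intro exI conjI)
    define q where "q = p + t *\<^sub>R d"
    have q: "q \<noteq> 0" using c t \<open>d \<noteq> 0\<close> by (simp add: q_def)
    show "(\<psi> has_real_derivative d \<bullet> (hessian k q *v d)) (at t)"
      using DERIV_gradient_along_line[of k p t d] k_gradient_diff[OF q]
      unfolding q_def \<psi>_def[symmetric] by blast
    have "(gradient k q - gradient k p) \<bullet> (q - p) = t * (\<psi> t - \<psi> 0)"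
      by (simp add: q_def \<psi>_def inner_diff_left)
    also have "\<dots> \<le> 1 * Q"
      unfolding Q_def using t mono[of t 1] mono[of 0 t] by (intro mult_mono) auto
    finally have "Fk * ((gradient k q - gradient k p) \<bullet> (q - p)) \<le> Fk * Q"
      using Fk_pos by simp
    then have "k q \<le> (1 + Ek) * k p + Fk * Q" using EFk[of q p] by (simp add: algebra_simps)
    then have "2 * \<epsilon>\<^sup>2 * \<gamma>\<^sup>2 * Dk * k q \<le> 2 * \<epsilon>\<^sup>2 * \<gamma>\<^sup>2 * Dk * ((1 + Ek) * k p + Fk * Q)"
      using Dk_pos by (intro mult_left_mono) auto
    \<comment> \<open>The fourth step-size bound limits the self-reference to
      \<open>Q / 3\<close>.\<close>
    moreover have "6 * (\<epsilon>\<^sup>2 * \<gamma>\<^sup>2 * Dk * Fk) * Q \<le> 1 * Q"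
      using eps4 mono[of 0 1] by (intro mult_right_mono) (auto simp: Q_def)
    ultimately have "2 * \<epsilon>\<^sup>2 * \<gamma>\<^sup>2 * Dk * k q + 6 * \<epsilon>\<^sup>2 * Dfk * (\<alpha> (2 * V) * V) \<le> N + Q / 3"
      by (simp add: N_def algebra_simps)
    then show "d \<bullet> (hessian k q *v d) \<le> 144 / 121 * (N + Q / 3)"
      using hessian_along_step[of t V] t q V by (simp add: q_def)
  qed
  show ?thesis
  proof (cases "d = 0")
    case True
    then show ?thesis using N by (simp add: N_def)
  next
    case False
    have tangent: "k (p + u *\<^sub>R d) + \<psi> u * (s - u) \<le> k (p + s *\<^sub>R d)" for u s
    proof -
      have "p + s *\<^sub>R d - (p + u *\<^sub>R d) = (s - u) *\<^sub>R d" by (simp add: algebra_simps)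
      then show ?thesis
        using convex_on_gradient_le[OF k_convex k_diff, of "p + u *\<^sub>R d" "p + s *\<^sub>R d"]
        by (simp add: \<psi>_def mult.commute)
    qed
    have deriv: "((\<lambda>t. k (p + t *\<^sub>R d)) has_real_derivative \<psi> t) (at t)" for t
      using DERIV_along_line[OF k_diff] by (simp add: \<psi>_def)
    note * = convex_second_order_bound[where c = c and \<phi> = "\<lambda>t. k (p + t *\<^sub>R d)" and \<psi> = \<psi>,
        OF deriv tangent bound[OF _ _ _ False]]
    \<comment> \<open>With \<open>M = 144 / 121 * (N + Q / 3)\<close>, the bound
      \<open>Q \<le> M\<close> gives \<open>Q \<le> 144 / 73 * N\<close>, hence
      \<open>M / 2 \<le> 72 / 73 * N\<close>.\<close>
    have "k (p + d) - k p - gradient k p \<bullet> d \<le> N"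
      using *[folded Q_def] N by (simp add: \<psi>_def)
    then show ?thesis by (simp add: N_def)
  qed
qed

text \<open>These are the two premises of \<open>implicit_solution_le\<close> for the target
  \<open>T\<close>: the first places \<open>T\<close> in the range where that comparison is valid,
  the second is the doubled decrease with the multiplier frozen at \<open>V\<close>.\<close>

lemma
  assumes V: "H x p \<le> 2 * V" "V = H x p + C / 2 * \<alpha> (2 * V) * ((x - xm) \<bullet> p)"
  defines "T \<equiv> V * (1 - \<epsilon> * C / 4 * (1 - \<gamma> - 2 * \<epsilon> * (Cfk + 6 * Dfk / C)) * \<alpha> (2 * V))"
  shows hamiltonian_step_le: "H x' (p + d) \<le> 2 * T"
    and lyapunov_step_le:
      "H x' (p + d) + C / 2 * \<alpha> (2 * V) * ((x' - xm) \<bullet> (p + d)) + 2 * (V - T) \<le> V"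
proof -
  define \<beta> L S F g where "\<beta> = C / 2 * \<alpha> (2 * V)" and "L = 1 - \<gamma> - 2 * \<epsilon> * (Cfk + 6 * Dfk / C)"
    and "S = (x - xm) \<bullet> p" and "F = f x - f xm" and "g = gradient k p \<bullet> p"
  have Vb: "(1 - C / 2) * H x p \<le> V" "V \<le> (1 + C / 2) * H x p"
    using implicit_solution_bounds[OF inner_rate_le hamiltonian_nonneg V] by auto
  have nonneg: "0 \<le> H x p" "0 \<le> V" "0 \<le> F" "0 \<le> k p"
    using hamiltonian_nonneg[of x p] V f_min[of x] k_nonneg[of p] by (auto simp: F_def)
  have H: "H x p = F + k p" by (simp add: hamiltonian_def F_def)
  have \<alpha>: "0 < \<alpha> (2 * V)" "\<alpha> (2 * V) \<le> 1" "\<alpha> (2 * V) \<le> \<alpha> (k p)"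
    using rate_pos[of "2 * V"] rate_le_one[of "2 * V"] rate_antimono[of "k p" "2 * V"] nonneg V(1) H
    by auto
  have \<beta>: "0 < \<beta>" "\<beta> \<le> C / 2" using \<alpha> C_pos by (auto simp: \<beta>_def)
  have VT: "2 * (V - T) = \<epsilon> * \<beta> * L * V"
    unfolding T_def L_def[symmetric] \<beta>_def by (simp add: algebra_simps)
  have VS: "V = F + k p + \<beta> * S" using V(2) H by (simp add: \<beta>_def S_def)

  define K G where "K = 2 * \<epsilon>\<^sup>2 * \<gamma>\<^sup>2 * (Dk * (1 + Ek)) * k p"
    and "G = 6 * \<epsilon>\<^sup>2 * Dfk * (\<alpha> (2 * V) * V)"
  \<comment> \<open>The second step-size bound fits \<open>K\<close> into the reserve left by
    \<open>dissipation_le\<close>.\<close>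
  have "8 * \<epsilon> * (Dk * (1 + Ek)) * (\<epsilon> * \<gamma>\<^sup>2 * k p / 4) \<le> (1 - \<gamma>) * (\<epsilon> * \<gamma>\<^sup>2 * k p / 4)"
    using eps2 eps_pos nonneg by (intro mult_right_mono) auto
  then have K: "K \<le> \<epsilon> * (\<gamma>\<^sup>2 * (1 - \<gamma>) / 4 * k p)"
    by (simp add: K_def power2_eq_square algebra_simps)
  \<comment> \<open>Writing \<open>\<alpha> (2 * V)\<close> as \<open>2 * \<beta> / C\<close> is the
    source of \<open>6 * Dfk / C\<close> in the rate.\<close>
  have G: "G = \<epsilon> * \<beta> * V * (2 * \<epsilon> * (6 * Dfk / C))"
    using C_pos by (simp add: G_def \<beta>_def power2_eq_square)
  have g: "k p \<le> g" using gradient_inner_self_ge by (simp add: g_def)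
  have "H x' (p + d) = k (p + d) + f x' - f xm" by (simp add: hamiltonian_def)
  also have "\<dots> \<le> (k p + gradient k p \<bullet> d + K + G) + (f x + \<epsilon> * (gradient f x' \<bullet> gradient k p)) - f xm"
    using kinetic_remainder_le[OF V(1) Vb(2)] position_increase_le by (simp add: K_def G_def)
  also have "\<dots> = F + k p - \<epsilon> * \<gamma> * g + K + G"
    by (simp add: d F_def g_def inner_add_right inner_commute algebra_simps)
  finally have H': "H x' (p + d) \<le> F + k p - \<epsilon> * \<gamma> * g + K + G" .

  show "H x' (p + d) \<le> 2 * T"
  proof -
    define Z where "Z = \<epsilon> * \<beta> * V * (1 - \<gamma>)"
    have "\<gamma> * (1 - \<gamma>) \<le> 1 * 1" using gamma by (intro mult_mono) auto
    then have "(\<epsilon> * \<gamma> * k p) * (\<gamma> * (1 - \<gamma>) / 4) \<le> (\<epsilon> * \<gamma> * k p) * 1"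
      using gamma eps_pos nonneg by (intro mult_left_mono) auto
    moreover have "\<epsilon> * \<gamma> * k p \<le> \<epsilon> * \<gamma> * g" using g eps_pos gamma by simp
    ultimately have "K \<le> \<epsilon> * \<gamma> * g"
      using K by (simp add: power2_eq_square algebra_simps)
    then have 1: "H x' (p + d) \<le> H x p + G" using H' H by linarith
    have 2: "G \<le> Z"
    proof -
      have "2 * \<epsilon> * (6 * Dfk / C) \<le> 2 * \<epsilon> * (Cfk + 6 * Dfk / C)"
        using eps_pos Cfk_pos by (intro mult_left_mono) auto
      then have "2 * \<epsilon> * (6 * Dfk / C) \<le> 1 - \<gamma>" using eps1 by linarith
      then have "\<epsilon> * \<beta> * V * (2 * \<epsilon> * (6 * Dfk / C)) \<le> \<epsilon> * \<beta> * V * (1 - \<gamma>)"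
        using eps_pos \<beta> nonneg by (intro mult_left_mono) auto
      then show ?thesis using G by (simp only: Z_def)
    qed
    have "\<epsilon> * \<beta> * V * L \<le> Z"
      unfolding L_def Z_def using eps_pos \<beta> nonneg Cfk_pos Dfk_pos C_pos
      by (intro mult_left_mono) auto
    then have 3: "2 * V \<le> 2 * T + Z" using VT by (simp add: algebra_simps)
    have "2 * Z \<le> (1 - C) * H x p"
    proof -
      have "\<epsilon> * \<beta> \<le> \<epsilon> * (\<gamma> / 2)" using \<beta> C_le eps_pos by (intro mult_left_mono) auto
      then have "\<epsilon> * \<beta> \<le> 1 / 24" using eps_gamma_le by simp
      moreover have "V \<le> 3 / 2 * H x p"
        using Vb(2) mult_right_mono[of C 1 "H x p"] C_less_one nonneg by (simp add: algebra_simps)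
      ultimately have "\<epsilon> * \<beta> * V \<le> 1 / 24 * (3 / 2 * H x p)"
        using eps_pos \<beta> nonneg by (intro mult_mono) auto
      then have "2 * (\<epsilon> * \<beta> * V) * (1 - \<gamma>) \<le> H x p * (1 - C)"
        using nonneg gamma C_le eps_pos \<beta> by (intro mult_mono) auto
      then show ?thesis by (simp add: Z_def algebra_simps)
    qed
    then have 4: "2 * Z \<le> H x p - C * H x p" by (simp add: algebra_simps)
    have 5: "2 * H x p - C * H x p \<le> 2 * V" using Vb(1) by (simp add: algebra_simps)
    \<comment> \<open>The chain is \<open>H x' (p + d) \<le> H x p + Z \<le> (2 - C) * H x p - Z
      \<le> 2 * V - Z \<le> 2 * T\<close>.\<close>
    show ?thesis using 1 2 3 4 5 by linarith
  qed

  define S' where "S' = (x' - xm) \<bullet> (p + d)"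
  have "S' = (1 - \<epsilon> * \<gamma>) * (S + \<epsilon> * g) - \<epsilon> * ((x' - xm) \<bullet> gradient f x')"
  proof -
    have "p + d = (1 - \<epsilon> * \<gamma>) *\<^sub>R p - \<epsilon> *\<^sub>R gradient f x'" by (simp add: d algebra_simps)
    moreover have "(x' - xm) \<bullet> p = S + \<epsilon> * g"
      by (simp add: x' S_def g_def inner_diff_left inner_add_left)
    ultimately show ?thesis by (simp add: S'_def inner_diff_right)
  qed
  \<comment> \<open>Convexity at \<open>x'\<close> makes the pairing dissipate the objective gap.
    Returning from \<open>x'\<close> to \<open>x\<close> costs the \<open>Cfk\<close> term, which
    \<open>H x p \<le> 2 * V\<close> turns into the \<open>Cfk\<close> term of the rate.\<close>
  moreover have "\<epsilon> * (F - \<epsilon> * Cfk * H x p) \<le> \<epsilon> * ((x' - xm) \<bullet> gradient f x')"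
  proof -
    have "f x' - f xm \<le> (x' - xm) \<bullet> gradient f x'"
      using convex_on_gradient_le[OF f_convex f_diff, of x' xm]
      by (simp add: inner_diff_right inner_diff_left inner_commute)
    then show ?thesis
      using position_decrease_le eps_pos by (intro mult_left_mono) (auto simp: F_def)
  qed
  ultimately have "S' \<le> (1 - \<epsilon> * \<gamma>) * (S + \<epsilon> * g) - \<epsilon> * (F - \<epsilon> * Cfk * H x p)" by simp
  then have "\<beta> * S' \<le> \<beta> * ((1 - \<epsilon> * \<gamma>) * (S + \<epsilon> * g) - \<epsilon> * (F - \<epsilon> * Cfk * H x p))"
    using \<beta> by simp
  also have "\<dots> = \<beta> * S - \<epsilon> * (\<gamma> * (\<beta> * S) + \<beta> * F) + \<epsilon> * \<beta> * g - \<epsilon> * \<gamma> * (\<epsilon> * \<beta> * g)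
      + \<epsilon> * \<beta> * (\<epsilon> * Cfk * H x p)"
    by (simp add: algebra_simps)
  finally have bS': "\<beta> * S' \<le> \<dots>" .
  have drift: "\<epsilon> * \<beta> * (\<epsilon> * Cfk * H x p) \<le> \<epsilon> * \<beta> * (\<epsilon> * Cfk * (2 * V))"
    using V(1) eps_pos \<beta> Cfk_pos by (intro mult_left_mono) auto
  have g_drop: "0 \<le> \<epsilon> * \<gamma> * (\<epsilon> * \<beta> * g)"
    using eps_pos gamma \<beta> g nonneg by (intro mult_nonneg_nonneg) auto
  \<comment> \<open>The first-order terms in \<open>g\<close> combine to
    \<open>- \<epsilon> * (\<gamma> - \<beta>) * g\<close>, and \<beta> \<le> \<gamma> allows
    \<open>k p\<close> to replace \<open>g\<close>.\<close>
  have g_ge: "\<epsilon> * (\<gamma> - \<beta>) * k p \<le> \<epsilon> * (\<gamma> - \<beta>) * g"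
    using g eps_pos \<beta> C_le C_pos by (intro mult_left_mono) auto
  have dissipation: "\<epsilon> * ((1 - \<gamma>) * \<beta> * V)
      \<le> \<epsilon> * ((\<gamma> - \<beta>) * k p + \<gamma> * (\<beta> * S) + \<beta> * F - \<gamma>\<^sup>2 * (1 - \<gamma>) / 4 * k p)"
    unfolding VS
  proof (intro mult_left_mono dissipation_le)
    have "\<alpha> (2 * V) * \<bar>S\<bar> \<le> k p + \<alpha> (2 * V) * F"
      using inner_le_of_rate[OF \<alpha>(1,3), of x] by (simp add: S_def F_def)
    then have "C / 2 * (\<alpha> (2 * V) * \<bar>S\<bar>) \<le> C / 2 * (k p + \<alpha> (2 * V) * F)"
      using C_pos by simp
    moreover have "\<bar>\<beta> * S\<bar> = C / 2 * (\<alpha> (2 * V) * \<bar>S\<bar>)"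
      using \<alpha>(1) C_pos by (simp add: abs_mult \<beta>_def)
    ultimately have "\<bar>\<beta> * S\<bar> \<le> \<beta> * F + C / 2 * k p"
      by (simp add: \<beta>_def algebra_simps)
    then show "- (\<beta> * F + C / 2 * k p) \<le> \<beta> * S" by linarith
  qed (use gamma C_pos C_le \<beta> nonneg eps_pos in auto)
  define Y where "Y = \<gamma>\<^sup>2 * (1 - \<gamma>) / 4 * k p"
  have "\<epsilon> * \<beta> * L * V = \<epsilon> * ((1 - \<gamma>) * \<beta> * V) - \<epsilon> * \<beta> * (\<epsilon> * Cfk * (2 * V)) - G"
    unfolding G L_def by (simp add: algebra_simps)
  moreover have "F + k p + \<beta> * S \<le> V" using VS by simp
  ultimately have "H x' (p + d) + \<beta> * S' + \<epsilon> * \<beta> * L * V \<le> V"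
    using H' bS' drift g_drop g_ge dissipation[folded Y_def] K[folded Y_def]
    by (simp add: algebra_simps)
  then show "H x' (p + d) + C / 2 * \<alpha> (2 * V) * ((x' - xm) \<bullet> (p + d)) + 2 * (V - T) \<le> V"
    unfolding VT \<beta>_def[symmetric] S'_def .
qed

end

section \<open>Iterating the descent\<close>

abbreviation contraction where
  "contraction \<equiv> \<epsilon> * C / 4 * (1 - \<gamma> - 2 * \<epsilon> * (Cfk + 6 * Dfk / C))"

lemma contraction_bounds: "0 \<le> contraction" "contraction \<le> 1"
proof -
  have L: "0 \<le> 1 - \<gamma> - 2 * \<epsilon> * (Cfk + 6 * Dfk / C)" "1 - \<gamma> - 2 * \<epsilon> * (Cfk + 6 * Dfk / C) \<le> 1"
  proof -
    have "0 \<le> 2 * \<epsilon> * (Cfk + 6 * Dfk / C)" using eps_pos Cfk_pos Dfk_pos C_pos by simp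
    then show "1 - \<gamma> - 2 * \<epsilon> * (Cfk + 6 * Dfk / C) \<le> 1" using gamma by linarith
  qed (use eps1 in simp)
  then show "0 \<le> contraction" using eps_pos C_pos by simp
  have "\<epsilon> * C \<le> \<epsilon> * \<gamma>" using C_le eps_pos by simp
  then have "\<epsilon> * C / 4 \<le> 1" using eps_gamma_le by simp
  then have "contraction \<le> 1 * 1" using L eps_pos C_pos by (intro mult_mono) auto
  then show "contraction \<le> 1" by simp
qed

lemma contraction_rate_le_one: "0 \<le> y \<Longrightarrow> contraction * \<alpha> y \<le> 1"
  using mult_mono[OF contraction_bounds(2) rate_le_one[of y]] contraction_bounds(1) rate_pos[of y] by simp

lemma contraction_mono:
  assumes "0 \<le> v" "v \<le> w"
  shows "v * (1 - contraction * \<alpha> (2 * v)) \<le> w * (1 - contraction * \<alpha> (2 * w))"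
proof (rule mult_mono)
  have "contraction * \<alpha> (2 * w) \<le> contraction * \<alpha> (2 * v)"
    using assms contraction_bounds(1) by (intro mult_left_mono rate_antimono) auto
  then show "1 - contraction * \<alpha> (2 * v) \<le> 1 - contraction * \<alpha> (2 * w)" by simp
  show "0 \<le> 1 - contraction * \<alpha> (2 * v)" using contraction_rate_le_one[of "2 * v"] assms by simp
qed (use assms in auto)

text \<open>The induction step for the invariant: a new implicit solution exists, the comparison
  principle puts it below the target \<open>T\<close>, and \<open>contraction_mono\<close> replaces
  \<open>V\<close> by its majorant \<open>w\<close>.\<close>

lemma lyapunov_descent:
  assumes x': "x' = x + \<epsilon> *\<^sub>R gradient k p"
    and p': "p' = (1 - \<epsilon> * \<gamma>) *\<^sub>R p - \<epsilon> *\<^sub>R gradient f x'"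
    and V: "H x p \<le> 2 * V" "V = H x p + C / 2 * \<alpha> (2 * V) * ((x - xm) \<bullet> p)" "V \<le> w"
  obtains V' where "H x' p' \<le> 2 * V'" "V' = H x' p' + C / 2 * \<alpha> (2 * V') * ((x' - xm) \<bullet> p')"
    "V' \<le> w * (1 - contraction * \<alpha> (2 * w))"
proof -
  define d where "d = - \<epsilon> *\<^sub>R (\<gamma> *\<^sub>R p + gradient f x')"
  define T where "T = V * (1 - contraction * \<alpha> (2 * V))"
  have V0: "0 \<le> V" using V(1) hamiltonian_nonneg[of x p] by linarith
  have "p' = p + d" by (simp add: p' d_def algebra_simps)
  then have T: "H x' p' \<le> 2 * T"
    "H x' p' + C / 2 * \<alpha> (2 * V) * ((x' - xm) \<bullet> p') + 2 * (V - T) \<le> V"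
    using hamiltonian_step_le[OF x' d_def V(1,2)] lyapunov_step_le[OF x' d_def V(1,2)]
    by (simp_all add: T_def)
  have "T \<le> V"
    unfolding T_def using V0 contraction_bounds(1) rate_pos[of "2 * V"]
      contraction_rate_le_one[of "2 * V"] by (intro mult_right_le_one_le) auto
  obtain V' where V': "H x' p' \<le> 2 * V'" "V' = H x' p' + C / 2 * \<alpha> (2 * V') * ((x' - xm) \<bullet> p')"
    using implicit_solution_exists[OF inner_rate_le hamiltonian_nonneg] by blast
  have "V' \<le> T"
    by (rule implicit_solution_le[OF inner_rate_le hamiltonian_nonneg V' T(1) \<open>T \<le> V\<close> T(2)])
  also have "T \<le> w * (1 - contraction * \<alpha> (2 * w))"
    unfolding T_def using contraction_mono[OF V0 V(3)] .
  finally show ?thesis using that V' by blast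
qed

end

section \<open>From the stated hypotheses to the bounds on the iterates\<close>

lemma strictly_convex_on_imp_convex_on:
  assumes "strictly_convex_on S f"
  shows "convex_on S f"
proof (rule convex_onI)
  fix t :: real and x y assume *: "0 < t" "t < 1" "x \<in> S" "y \<in> S"
  show "f ((1 - t) *\<^sub>R x + t *\<^sub>R y) \<le> (1 - t) * f x + t * f y"
  proof (cases "x = y")
    case True
    then show ?thesis by (simp add: algebra_simps)
  next
    case False
    have "(1 - t) + t = 1" "0 < 1 - t" using * by simp_all
    then show ?thesis
      using assms * False unfolding strictly_convex_on_def by (meson less_imp_le)
  qed
qed (use assms in \<open>simp add: strictly_convex_on_def\<close>)

text \<open>Fenchel-Young: the supremum is tested at \<open>x - xm\<close>. Staying in the extended
  reals until the conjugate is eliminated avoids assuming it finite.\<close>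

lemma inner_le_of_convex_conjugate_le:
  assumes "ereal a * convex_conjugate (centered f xm) p \<le> ereal b" "0 < a"
  shows "a * ((x - xm) \<bullet> p) \<le> b + a * (f x - f xm)"
proof -
  have "ereal ((x - xm) \<bullet> p - (f x - f xm)) \<le> convex_conjugate (centered f xm) p"
    unfolding convex_conjugate_def by (rule SUP_upper2[of "x - xm"]) (auto simp: centered_def)
  then have "ereal a * ereal ((x - xm) \<bullet> p - (f x - f xm)) \<le> ereal a * convex_conjugate (centered f xm) p"
    using assms(2) by (intro ereal_mult_left_mono) auto
  then have "ereal a * ereal ((x - xm) \<bullet> p - (f x - f xm)) \<le> ereal b"
    using assms(1) by (rule order_trans)
  then show ?thesis by (simp add: algebra_simps)
qed

theorem proposition3p4:
  fixes f k :: "real ^ 'd \<Rightarrow> real"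
    and xstar :: "real ^ 'd"
    and \<gamma> \<epsilon> :: real
    and \<alpha> \<alpha>' :: "real \<Rightarrow> real"
    and C\<alpha>\<gamma> Cfk Ck Dk Ek Fk Dfk :: real
    and x p :: "nat \<Rightarrow> real ^ 'd"
    and H0 \<alpha>star :: real
    and W :: "nat \<Rightarrow> real"
  assumes f_diff: "\<forall>y. f differentiable (at y)"
    and f_convex: "convex_on UNIV f"
    and f_min: "unique_minimizer f xstar"
    and k_diff: "\<forall>q. k differentiable (at q)"
    and k_strictly_convex: "strictly_convex_on UNIV k"
    and k_zero: "k 0 = 0"
    and k_min: "\<forall>q. k 0 \<le> k q"
    and k_C2: "twice_continuously_differentiable_on k (UNIV - {0})"
    and gamma: "0 < \<gamma>" "\<gamma> < 1"
    \<comment> \<open>(i)\<close>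
    and alpha_range: "\<forall>y\<ge>0. 0 < \<alpha> y \<and> \<alpha> y \<le> 1"
    and alpha_deriv: "\<forall>y\<ge>0. (\<alpha> has_real_derivative \<alpha>' y) (at y within {0..})"
    and alpha_noninc: "antimono_on {0..} \<alpha>"
    and alpha_convex: "convex_on {0..} \<alpha>"
    and C\<alpha>\<gamma>: "0 < C\<alpha>\<gamma>" "C\<alpha>\<gamma> \<le> \<gamma>"
    and k_lower: "\<forall>q. ereal (k q) \<ge>
        ereal (\<alpha> (k q)) * max (convex_conjugate (centered f xstar) q)
                              (convex_conjugate (centered f xstar) (- q))"
    and alpha_growth: "\<forall>y\<ge>0. - C\<alpha>\<gamma> * \<alpha>' y * y < \<alpha> y"
    \<comment> \<open>(ii)\<close>
    and Cfk: "0 < Cfk"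
      "\<forall>y q. \<bar>gradient f y \<bullet> gradient k q\<bar> \<le> Cfk * hamiltonian f k xstar y q"
    \<comment> \<open>(iii)\<close>
    and Ck: "0 < Ck" "\<forall>q. gradient k q \<bullet> q \<le> Ck * k q"
    \<comment> \<open>(iv)\<close>
    and Dk: "0 < Dk" "\<forall>q. q \<noteq> 0 \<longrightarrow> q \<bullet> (hessian k q *v q) \<le> Dk * k q"
    \<comment> \<open>(v)\<close>
    and EFk: "0 < Ek" "0 < Fk"
      "\<forall>q r. k q - k r \<le> Ek * k r + Fk * ((gradient k q - gradient k r) \<bullet> (q - r))"
    \<comment> \<open>(vi)\<close>
    and Dfk: "0 < Dfk"
      "\<forall>y q. q \<noteq> 0 \<longrightarrow>
         gradient f y \<bullet> (hessian k q *v gradient f y)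
           \<le> Dfk * \<alpha> (3 * hamiltonian f k xstar y q) * hamiltonian f k xstar y q"
    and eps: "0 < \<epsilon>"
      "\<epsilon> < Min {(1 - \<gamma>) / (2 * (Cfk + 6 * Dfk / C\<alpha>\<gamma>)),
                 (1 - \<gamma>) / (8 * Dk * (1 + Ek)),
                 C\<alpha>\<gamma> / (6 * (5 * Cfk + 2 * \<gamma> * Ck) + 12 * \<gamma> * C\<alpha>\<gamma>),
                 sqrt (1 / (6 * \<gamma>\<^sup>2 * Dk * Fk))}"
    and p_init: "p 0 = 0"
    and x_step: "\<forall>i. x (Suc i) = x i + \<epsilon> *\<^sub>R gradient k (p i)"
    and p_step: "\<forall>i. p (Suc i) = (1 - \<epsilon> * \<gamma>) *\<^sub>R p i - \<epsilon> *\<^sub>R gradient f (x (Suc i))"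
    and H0: "H0 = hamiltonian f k xstar (x 0) (p 0)"
    and alpha_star: "\<alpha>star = \<alpha> (3 * H0)"
    and W_init: "W 0 = f (x 0) - f xstar"
    and W_step: "\<forall>i. W (Suc i) =
        W i * (1 - \<epsilon> * C\<alpha>\<gamma> / 4 * (1 - \<gamma> - 2 * \<epsilon> * (Cfk + 6 * Dfk / C\<alpha>\<gamma>)) * \<alpha> (2 * W i))"
  shows "\<forall>i. f (x i) - f xstar \<le> 2 * W i \<and>
      2 * W i \<le> 2 * W 0 *
        (1 - \<epsilon> * C\<alpha>\<gamma> / 4 * (1 - \<gamma> - 2 * \<epsilon> * (Cfk + 6 * Dfk / C\<alpha>\<gamma>)) * \<alpha>star) ^ i"
proof -
  have \<epsilon>: "\<epsilon> < (1 - \<gamma>) / (2 * (Cfk + 6 * Dfk / C\<alpha>\<gamma>))"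
    "\<epsilon> < (1 - \<gamma>) / (8 * Dk * (1 + Ek))"
    "\<epsilon> < C\<alpha>\<gamma> / (6 * (5 * Cfk + 2 * \<gamma> * Ck) + 12 * \<gamma> * C\<alpha>\<gamma>)"
    "\<epsilon> < sqrt (1 / (6 * \<gamma>\<^sup>2 * Dk * Fk))"
    using eps(2) by auto
  interpret hamiltonian_descent \<alpha> \<alpha>' C\<alpha>\<gamma> f k xstar \<gamma> \<epsilon> Cfk Ck Dk Ek Fk Dfk
  proof
    show "0 < \<alpha> y" "\<alpha> y \<le> 1" "(\<alpha> has_real_derivative \<alpha>' y) (at y within {0..})"
      "- C\<alpha>\<gamma> * \<alpha>' y * y < \<alpha> y" if "0 \<le> y" for y
      using that alpha_range alpha_deriv alpha_growth by auto
    show "\<alpha> z \<le> \<alpha> y" if "0 \<le> y" "y \<le> z" for y z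
      using that alpha_noninc by (auto simp: monotone_on_def)
    show "k q \<ge> 0" for q using k_min k_zero by simp
    show "convex_on UNIV k" using k_strictly_convex by (rule strictly_convex_on_imp_convex_on)
    show "gradient k differentiable (at q)" if "q \<noteq> 0" for q
      using k_C2 that by (auto simp: twice_continuously_differentiable_on_def)
    show "f xstar \<le> f y" for y using f_min by (simp add: unique_minimizer_def)
    show "\<alpha> (k q) * \<bar>(y - xstar) \<bullet> q\<bar> \<le> k q + \<alpha> (k q) * (f y - f xstar)" for q y
    proof -
      have a: "0 < \<alpha> (k q)" using alpha_range k_min k_zero by simp
      have *: "ereal (\<alpha> (k q)) * convex_conjugate (centered f xstar) r \<le> ereal (k q)"
        if "r = q \<or> r = - q" for r
      proof -
        have "ereal (\<alpha> (k q)) * convex_conjugate (centered f xstar) r \<le> ereal (\<alpha> (k q)) *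
            max (convex_conjugate (centered f xstar) q) (convex_conjugate (centered f xstar) (- q))"
          using that a by (intro ereal_mult_left_mono) auto
        then show ?thesis using k_lower order_trans by blast
      qed
      \<comment> \<open>The conjugates at \<open>q\<close> and \<open>- q\<close> give the two signs
        of the inner product.\<close>
      show ?thesis
        using inner_le_of_convex_conjugate_le[OF * a, of q y]
          inner_le_of_convex_conjugate_le[OF * a, of "- q" y]
        by (auto simp: abs_if)
    qed
    have pos: "0 < 2 * (Cfk + 6 * Dfk / C\<alpha>\<gamma>)" "0 < 8 * Dk * (1 + Ek)"
      "0 < 6 * (5 * Cfk + 2 * \<gamma> * Ck) + 12 * \<gamma> * C\<alpha>\<gamma>" "0 < 6 * \<gamma>\<^sup>2 * Dk * Fk"
      using Cfk(1) Dfk(1) C\<alpha>\<gamma>(1) Dk(1) EFk(1,2) gamma(1) Ck(1) by (simp_all add: add_pos_pos)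
    show "2 * \<epsilon> * (Cfk + 6 * Dfk / C\<alpha>\<gamma>) \<le> 1 - \<gamma>"
      using \<epsilon>(1) unfolding pos_less_divide_eq[OF pos(1)] by (simp add: algebra_simps)
    show "8 * \<epsilon> * (Dk * (1 + Ek)) \<le> 1 - \<gamma>"
      using \<epsilon>(2) unfolding pos_less_divide_eq[OF pos(2)] by (simp add: algebra_simps)
    show "30 * (\<epsilon> * Cfk) + 12 * (\<epsilon> * \<gamma> * Ck) + 12 * (\<epsilon> * \<gamma>) * C\<alpha>\<gamma> \<le> C\<alpha>\<gamma>"
      using \<epsilon>(3) unfolding pos_less_divide_eq[OF pos(3)] by (simp add: algebra_simps)
    have "\<epsilon>\<^sup>2 \<le> 1 / (6 * \<gamma>\<^sup>2 * Dk * Fk)"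
      using power_mono[of \<epsilon> "sqrt (1 / (6 * \<gamma>\<^sup>2 * Dk * Fk))" 2] \<epsilon>(4) eps(1) pos(4) by simp
    then show "6 * (\<epsilon>\<^sup>2 * \<gamma>\<^sup>2 * Dk * Fk) \<le> 1"
      unfolding pos_le_divide_eq[OF pos(4)] by (simp add: algebra_simps)
  qed (use assms in auto)
  have W: "W (Suc i) = W i * (1 - contraction * \<alpha> (2 * W i))" for i using W_step by simp
  have W0: "W 0 = H0" by (simp add: W_init H0 hamiltonian_def p_init k_zero)
  have H0_nonneg: "0 \<le> H0" unfolding H0 by (rule hamiltonian_nonneg)
  have lyapunov: "\<exists>V. H (x i) (p i) \<le> 2 * V
      \<and> V = H (x i) (p i) + C\<alpha>\<gamma> / 2 * \<alpha> (2 * V) * ((x i - xstar) \<bullet> p i) \<and> V \<le> W i" for i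
  proof (induction i)
    case 0
    \<comment> \<open>Zero initial momentum removes the correction term, so \<open>H0\<close> itself
      solves the implicit equation.\<close>
    have "(x 0 - xstar) \<bullet> p 0 = 0" by (simp add: p_init)
    then show ?case using H0_nonneg by (intro exI[of _ H0]) (simp add: W0 H0[symmetric])
  next
    case (Suc i)
    then obtain V where V: "H (x i) (p i) \<le> 2 * V"
      "V = H (x i) (p i) + C\<alpha>\<gamma> / 2 * \<alpha> (2 * V) * ((x i - xstar) \<bullet> p i)" "V \<le> W i" by blast
    show ?case
      unfolding W by (rule lyapunov_descent[OF x_step[rule_format] p_step[rule_format] V]) blast
  qed
  have W_nonneg: "0 \<le> W i" for i
    using lyapunov[of i] hamiltonian_nonneg[of "x i" "p i"] by fastforce
  have W_dec: "W i \<le> W 0" for i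
  proof (induction i)
    case (Suc i)
    have "W (Suc i) \<le> W i"
      unfolding W using W_nonneg[of i] contraction_bounds(1) rate_pos[of "2 * W i"]
        contraction_rate_le_one[of "2 * W i"] by (intro mult_right_le_one_le) auto
    with Suc show ?case by simp
  qed simp
  have geometric: "W i \<le> W 0 * (1 - contraction * \<alpha>star) ^ i" for i
  proof (induction i)
    case (Suc i)
    \<comment> \<open>Since \<open>W i\<close> never exceeds \<open>W 0 = H0\<close>, the rate in
      each step is at least \<open>\<alpha>star\<close>.\<close>
    have "2 * W i \<le> 3 * H0" using W_dec[of i] W0 H0_nonneg by simp
    then have "contraction * \<alpha>star \<le> contraction * \<alpha> (2 * W i)"
      unfolding alpha_star using W_nonneg[of i] contraction_bounds(1)
      by (intro mult_left_mono rate_antimono) auto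
    then have "W (Suc i) \<le> W i * (1 - contraction * \<alpha>star)"
      unfolding W using W_nonneg[of i] by (intro mult_left_mono) auto
    also have "\<dots> \<le> W 0 * (1 - contraction * \<alpha>star) ^ i * (1 - contraction * \<alpha>star)"
      using Suc contraction_rate_le_one[of "3 * H0"] H0_nonneg
      by (intro mult_right_mono) (auto simp: alpha_star)
    finally show ?case by (simp add: mult_ac)
  qed simp
  show ?thesis
  proof (intro allI conjI)
    fix i
    obtain V where "H (x i) (p i) \<le> 2 * V" "V \<le> W i" using lyapunov by blast
    then show "f (x i) - f xstar \<le> 2 * W i"
      using k_nonneg[of "p i"] by (simp add: hamiltonian_def)
    show "2 * W i \<le> 2 * W 0 * (1 - contraction * \<alpha>star) ^ i"
      using geometric[of i] by simp
  qed
qed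

end
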